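(* Let $d\ge 1$ be fixed. Let $P$ be a Borel probability distribution on $\mathbb{R}^d$ such that every hyperplane has $P$-measure zero. Then, for integers $n>d$ with $n-d$ even, $$E_P\left(\tfrac{n-d}{2},n\right)=O\left(n^{d-1/2}\right),$$ where the constants in the big-$O$ depend only on $d$ (and not on $P$).
   Context: A set of at least $d+1$ points in $\mathbb{R}^d$ is in general position if no $d+1$ (and thus, fewer) of its points are affinely dependent. For a finite set $S\subset\mathbb{R}^d$ in general position, a $k$-facet of $S$ is a subset $\Delta\subset S$ of size $d$ such that one of the two open halfspaces bounded by the hyperplane $\operatorname{aff}\Delta$ contains exactly $k$ points of $S$. For a Borel probability distribution $P$ on $\mathbb{R}^d$ for which every hyperplane has measure zero, a sample of i.i.d. points from $P$ is in general position with probability 1, and $E_P(k,n)$ denotes the expected number of $k$-facets of a set of $n$ i.i.d. random points drawn from $P$. *)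

theory Defs
  imports "HOL-Probability.Probability"
begin

text \<open>
  The hyperplanes of \<open>real ^ 'n\<close> are the sets \<open>{x. a \<bullet> x = b}\<close> with \<open>a \<noteq> 0\<close>. The two open
  halfspaces bounded by one do not depend, as a pair, on the choice of \<open>a\<close> and \<open>b\<close>.

  The definition is intended for finite \<open>S\<close> in general position. On other sets it only
  counts those \<open>\<Delta>\<close> whose affine hull is a hyperplane. Such sets do not affect \<open>expected_k_facets\<close>
  below for a distribution that vanishes on hyperplanes, because a sample is then almost surely
  in general position.
\<close>

definition k_facet :: "nat \<Rightarrow> (real ^ 'n::finite) set \<Rightarrow> (real ^ 'n) set \<Rightarrow> bool" where
  "k_facet k S \<Delta> \<longleftrightarrow>
     \<Delta> \<subseteq> S \<and> card \<Delta> = CARD('n) \<and>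
     (\<exists>a b. a \<noteq> 0 \<and> affine hull \<Delta> = {x. a \<bullet> x = b} \<and>
        (card {x \<in> S. a \<bullet> x < b} = k \<or> card {x \<in> S. a \<bullet> x > b} = k))"

text \<open>
  The sample is the family of coordinates of the \<open>n\<close>-fold product of \<open>P\<close>. The expectation is
  taken in \<^typ>\<open>ennreal\<close>, which needs no integrability side condition.
\<close>

definition expected_k_facets :: "(real ^ 'n::finite) measure \<Rightarrow> nat \<Rightarrow> nat \<Rightarrow> ennreal" where
  "expected_k_facets P k n =
     (\<integral>\<^sup>+ X. of_nat (card {\<Delta>. k_facet k (X ` {..<n}) \<Delta>}) \<partial>(\<Pi>\<^sub>M i\<in>{..<n}. P))"

end

theory Submission
  imports Defs
begin

text \<open>
  Write \<open>d = CARD('n)\<close> and \<open>2 * k = n - d\<close>. Almost surely the \<open>n\<close> sample points are distinct, so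
  every \<open>k\<close>-facet comes from a set \<open>I\<close> of \<open>d\<close> indices, and by linearity the expected number of
  \<open>k\<close>-facets is at most the sum over the \<open>n choose d\<close> sets \<open>I\<close> of the probability that the
  hyperplane through the points indexed by \<open>I\<close> has exactly \<open>k\<close> of the other \<open>2 * k\<close> points on
  one side.

  Condition on the points indexed by \<open>I\<close>. The hyperplane is then fixed and the other points are
  independent, so each lies on a given side with the same probability \<open>p\<close>. Exactly half of them
  do with probability \<open>((2 * k) choose k) * (p * (1 - p)) ^ k\<close>. Whatever \<open>p\<close> is, this is at most
  \<open>((2 * k) choose k) / 4 ^ k\<close>, since \<open>p * (1 - p) \<le> 1 / 4\<close>; here the distribution disappears
  from the estimate, and it is here that halving matters. The central binomial
  coefficient contributes a factor of order \<open>n powr (- 1 / 2)\<close>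
  (\<open>central_binomial_le\<close>), and multiplying by \<open>n choose d \<le> n ^ d\<close> gives the theorem.

  The remaining difficulty is measurability. The condition that a hyperplane with some equation
  \<open>a \<bullet> x = b\<close> splits the sample evenly quantifies over \<open>a\<close> and \<open>b\<close>, whereas both the
  conditioning (Fubini) and the linearity of the expectation need measurable events. Therefore
  the side of the hyperplane on which a point \<open>v\<close> lies is read off the sign of a determinant,
  \<open>facet_side\<close>, which is a polynomial in the coordinates of all points involved. For points
  whose affine hull is a hyperplane it is a nonzero multiple of \<open>a \<bullet> v - b\<close>
  (\<open>facet_side_proportional\<close>). The sign of that multiple is unknown, so both signs are counted, at
  the cost of a factor 2 in the constant.
\<close>

section \<open>The central binomial coefficient\<close>

text \<open>
  The squared inequality goes through by induction because the ratio of consecutive coefficients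
  is \<open>2 * (2 * k + 1) / (k + 1)\<close> and \<open>(2 * k + 1) * (2 * k + 3) \<le> (2 * k + 2)\<^sup>2\<close>.
\<close>

lemma central_binomial_le:
  "real ((2 * k) choose k) * sqrt (2 * real k + 1) \<le> 4 ^ k"
proof -
  have sq: "real ((2 * k) choose k) ^ 2 * (2 * real k + 1) \<le> (4 ^ k) ^ 2"
  proof (induction k)
    case (Suc k)
    have nat: "Suc k * ((2 * Suc k) choose Suc k) = 2 * (2 * k + 1) * ((2 * k) choose k)"
    proof -
      have 1: "Suc k * ((2 * Suc k) choose Suc k) = (2 * Suc k) * ((2 * k + 1) choose k)"
        using Suc_times_binomial[of k "2 * k + 1"] by simp
      have 2: "Suc k * ((2 * k + 1) choose k) = (2 * k + 1) * ((2 * k) choose k)"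
        using Suc_times_binomial[of k "2 * k"] binomial_symmetric[of k "2 * k + 1"] by simp
      have "Suc k * (Suc k * ((2 * Suc k) choose Suc k)) 
          = Suc k * (2 * (2 * k + 1) * ((2 * k) choose k))"
        unfolding 1 using 2 by (metis mult.assoc mult.left_commute)
      thus ?thesis by (metis mult_cancel1 nat.distinct(1))
    qed
    define x y where "x = real ((2 * Suc k) choose Suc k)" and "y = real ((2 * k) choose k)"
    have xy: "(real k + 1) * x = 2 * (2 * real k + 1) * y"
      using arg_cong[OF nat, of real] unfolding x_def y_def of_nat_mult
      by (simp add: algebra_simps)
    have "(real k + 1)^2 * (x^2 * (2 * real k + 3)) = ((real k + 1) * x)^2 * (2 * real k + 3)"
      by (simp add: power2_eq_square)
    also have "\<dots> = (y^2 * (2 * real k + 1)) * (4 * ((2 * real k + 1) * (2 * real k + 3)))"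
      unfolding xy by (simp add: power2_eq_square algebra_simps)
    also have "\<dots> \<le> (4 ^ k) ^ 2 * (4 * ((2 * real k + 1) * (2 * real k + 3)))"
      using Suc.IH unfolding y_def by (intro mult_right_mono) auto
    also have "\<dots> \<le> (4 ^ k) ^ 2 * (16 * (real k + 1)^2)"
      by (intro mult_left_mono) (simp_all add: power2_eq_square algebra_simps)
    finally have "x^2 * (2 * real k + 3) \<le> (4 ^ k) ^ 2 * 16"
      by (simp add: mult.commute mult.left_commute)
    thus ?case
      unfolding x_def[symmetric] by (simp add: power_mult_distrib algebra_simps)
  qed simp
  have "(real ((2 * k) choose k) * sqrt (2 * real k + 1)) ^ 2 \<le> (4 ^ k) ^ 2"
    using sq by (simp add: power_mult_distrib)
  thus ?thesis by (rule power2_le_imp_le) simp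
qed

section \<open>The side of a hyperplane as the sign of a determinant\<close>

text \<open>
  Up to sign, this is \<open>d!\<close> times the volume of the simplex with vertices \<open>v\<close> and the \<open>d\<close> points
  \<open>p r\<close>. The base vertex \<open>r0\<close> serves as the origin, which frees row \<open>r0\<close> for \<open>v\<close>.
\<close>

definition facet_side :: "'n \<Rightarrow> ('n \<Rightarrow> real ^ 'n::finite) \<Rightarrow> real ^ 'n \<Rightarrow> real" where
  "facet_side r0 p v = det (\<chi> r. if r = r0 then v - p r0 else p r - p r0)"

lemma facet_side_measurable [measurable (raw)]:
  assumes [measurable]: "\<And>r. (\<lambda>x. p x r) \<in> borel_measurable M" "v \<in> borel_measurable M"
  shows "(\<lambda>x. facet_side r0 (p x) (v x)) \<in> borel_measurable M"
proof -
  have "(\<lambda>x. (\<chi> r. if r = r0 then v x - p x r0 else p x r - p x r0) $ i $ j) \<in> borel_measurable M"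
    for i j
    by (cases "i = r0")
      (simp_all add: borel_measurable_diff assms measurable_compose[OF _ borel_measurable_nth])
  thus ?thesis unfolding facet_side_def det_def
    by (intro borel_measurable_sum borel_measurable_times borel_measurable_prod) auto
qed

text \<open>
  The vectors \<open>p r - p r0\<close> with \<open>r \<noteq> r0\<close> span the orthogonal complement of \<open>a\<close>. Hence row
  operations reduce the row \<open>v - p r0\<close> to its component along \<open>a\<close>, and the determinant that
  remains is nonzero because its rows span the whole space.
\<close>

lemma facet_side_proportional:
  fixes p :: "'n::finite \<Rightarrow> real ^ 'n"
  assumes a: "a \<noteq> 0" and hull: "affine hull range p = {x. a \<bullet> x = b}"
  obtains c where "c \<noteq> 0" "\<And>v. facet_side r0 p v = c * (a \<bullet> v - b)"
proof -
  define D where "D = {p r - p r0 |r. r \<noteq> r0}"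
  define A where "A u = (\<chi> r. if r = r0 then u else p r - p r0)" for u
  have rowA: "row r (A u) = (if r = r0 then u else p r - p r0)" for r u
    by (simp add: A_def row_def vec_eq_iff)
  have D: "{row r (A u) |r. r \<noteq> r0} = D" for u
    unfolding rowA D_def by auto
  have b: "b = a \<bullet> p r0"
    using hull_inc[of "p r0" "range p" affine] hull by simp
  have perp: "w \<in> span D" if "a \<bullet> w = 0" for w
  proof -
    have "p r0 + w \<in> affine hull range p"
      using that by (simp add: hull b inner_add_right)
    also have "affine hull range p = affine hull (insert (p r0) (p ` (-{r0})))"
      by (rule arg_cong[of _ _ "\<lambda>S. affine hull S"]) auto
    finally have "w \<in> span ((\<lambda>x. - p r0 + x) ` p ` (-{r0}))"
      by (auto simp: affine_hull_insert_span_gen)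
    moreover have "(\<lambda>x. - p r0 + x) ` p ` (-{r0}) = D"
      unfolding D_def by (auto simp: image_iff)
    ultimately show ?thesis by simp
  qed
  have decomp: "u - ((a \<bullet> u) / (a \<bullet> a)) *\<^sub>R a \<in> span D" for u
    using a by (intro perp) (simp add: inner_diff_right)
  have det: "det (A u) = (a \<bullet> u) / (a \<bullet> a) * det (A a)" for u
  proof -
    define t where "t = (a \<bullet> u) / (a \<bullet> a)"
    have 1: "u - t *\<^sub>R a \<in> vec.span {row r (A (t *s a)) |r. r \<noteq> r0}"
      using decomp[of u] unfolding D t_def by (simp add: span_vec_eq)
    have "det (A u) = det (\<chi> k. if k = r0 then row r0 (A (t *s a)) + (u - t *\<^sub>R a)
                                 else row k (A (t *s a)))"
      unfolding rowA by (rule arg_cong[of _ _ det]) (simp add: A_def vec_eq_iff)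
    also have "\<dots> = det (A (t *s a))"
      by (rule det_row_span[OF 1])
    also have "\<dots> = t * det (A a)"
      unfolding A_def by (rule det_row_mul)
    finally show ?thesis unfolding t_def .
  qed
  have "span (rows (A a)) = UNIV"
  proof -
    have "u \<in> span (rows (A a))" for u
    proof -
      have "a \<in> rows (A a)" "D \<subseteq> rows (A a)"
        using rowA[of r0 a] unfolding rows_def D[of a, symmetric] by (auto intro: sym)
      hence "u - ((a \<bullet> u) / (a \<bullet> a)) *\<^sub>R a \<in> span (rows (A a))"
            "((a \<bullet> u) / (a \<bullet> a)) *\<^sub>R a \<in> span (rows (A a))"
        using decomp[of u] span_mono by (blast intro: span_scale span_base)+
      from span_add[OF this] show ?thesis by simp
    qed
    thus ?thesis by auto
  qed
  hence "det (A a) \<noteq> 0"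
    using matrix_left_invertible_span_rows invertible_left_inverse invertible_det_nz by metis
  moreover have "facet_side r0 p v = det (A a) / (a \<bullet> a) * (a \<bullet> v - b)" for v
  proof -
    have "facet_side r0 p v = det (A (v - p r0))"
      unfolding facet_side_def A_def ..
    thus ?thesis using det[of "v - p r0"] by (simp add: b inner_diff_right)
  qed
  ultimately show ?thesis using a by (intro that[of "det (A a) / (a \<bullet> a)"]) auto
qed

section \<open>Even splits by a hyperplane have small probability\<close>

text \<open>
  This is the anticoncentration of a binomial variable with \<open>2 * k\<close> trials at the value \<open>k\<close>,
  uniform in the success probability. The event is a union of product sets \<open>B A\<close>, one for each
  set \<open>A\<close> of \<open>k\<close> successful trials.
\<close>

lemma emeasure_PiM_half_in_le:
  assumes "prob_space P" and H [measurable]: "H \<in> sets P" and J: "finite J" "card J = 2 * k"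
  shows "emeasure (\<Pi>\<^sub>M j\<in>J. P) {Y \<in> space (\<Pi>\<^sub>M j\<in>J. P). card {j \<in> J. Y j \<in> H} = k}
    \<le> ennreal (1 / sqrt (2 * real k + 1))"
proof -
  interpret prob_space P by fact
  interpret Pi: product_prob_space "\<lambda>_. P" J ..
  define p where "p = prob H"
  define B where "B A = (\<Pi>\<^sub>E j\<in>J. if j \<in> A then H else space P - H)" for A
  define Q where "Q = {A. A \<subseteq> J \<and> card A = k}"
  have fin: "finite Q" using J unfolding Q_def by auto
  have cardQ: "card Q = (2 * k) choose k"
    unfolding Q_def using n_subsets[OF J(1), of k] J(2) by simp
  have p: "0 \<le> p" "p \<le> 1" unfolding p_def by auto
  have pp: "p * (1 - p) \<le> 1 / 4"
    using zero_le_power2[of "p - 1 / 2"] by (simp add: power2_eq_square algebra_simps)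
  have B: "emeasure (\<Pi>\<^sub>M j\<in>J. P) (B A) \<le> ennreal ((1 / 4) ^ k)" if "A \<in> Q" for A
  proof -
    have A: "A \<subseteq> J" "card A = k" using that unfolding Q_def by auto
    have "emeasure (\<Pi>\<^sub>M j\<in>J. P) (B A)
        = (\<Prod>j\<in>J. emeasure P (if j \<in> A then H else space P - H))"
      unfolding B_def using J(1) by (intro Pi.emeasure_PiM) auto
    also have "\<dots> = (\<Prod>j\<in>J. ennreal (if j \<in> A then p else 1 - p))"
      by (intro prod.cong) (auto simp: emeasure_eq_measure p_def prob_compl)
    also have "\<dots> = ennreal (\<Prod>j\<in>J. if j \<in> A then p else 1 - p)"
      using p by (intro prod_ennreal) auto
    also have "(\<Prod>j\<in>J. if j \<in> A then p else 1 - p) = p ^ card A * (1 - p) ^ card (J - A)"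
      using J(1) A(1) by (simp add: prod.If_cases Int_absorb1 Diff_eq)
    also have "card (J - A) = k"
      using A J finite_subset[OF A(1)] by (simp add: card_Diff_subset)
    also have "p ^ card A * (1 - p) ^ k = (p * (1 - p)) ^ k"
      using A by (simp add: power_mult_distrib)
    also have "\<dots> \<le> (1 / 4) ^ k"
      using p pp by (intro power_mono) auto
    finally show ?thesis by (simp add: ennreal_leI)
  qed
  have "{Y \<in> space (\<Pi>\<^sub>M j\<in>J. P). card {j \<in> J. Y j \<in> H} = k} \<subseteq> (\<Union>A\<in>Q. B A)"
  proof
    fix Y assume "Y \<in> {Y \<in> space (\<Pi>\<^sub>M j\<in>J. P). card {j \<in> J. Y j \<in> H} = k}"
    hence Y: "Y \<in> space (\<Pi>\<^sub>M j\<in>J. P)" "card {j \<in> J. Y j \<in> H} = k" by auto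
    have "{j \<in> J. Y j \<in> H} \<in> Q" using Y unfolding Q_def by auto
    moreover have "Y \<in> B {j \<in> J. Y j \<in> H}"
      using Y unfolding B_def space_PiM by (auto simp: PiE_iff)
    ultimately show "Y \<in> (\<Union>A\<in>Q. B A)" by blast
  qed
  hence "emeasure (\<Pi>\<^sub>M j\<in>J. P) {Y \<in> space (\<Pi>\<^sub>M j\<in>J. P). card {j \<in> J. Y j \<in> H} = k}
      \<le> emeasure (\<Pi>\<^sub>M j\<in>J. P) (\<Union>A\<in>Q. B A)"
    by (rule emeasure_mono)
      (use fin J(1) in \<open>auto simp: B_def intro!: sets.finite_UN sets_PiM_I_finite\<close>)
  also have "\<dots> \<le> (\<Sum>A\<in>Q. emeasure (\<Pi>\<^sub>M j\<in>J. P) (B A))"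
    by (rule emeasure_subadditive_finite)
      (use fin J(1) in \<open>auto simp: B_def intro!: sets_PiM_I_finite\<close>)
  also have "\<dots> \<le> (\<Sum>A\<in>Q. ennreal ((1 / 4) ^ k))"
    by (intro sum_mono B)
  also have "\<dots> = ennreal (real ((2 * k) choose k) / 4 ^ k)"
    by (simp add: cardQ ennreal_of_nat_eq_real_of_nat ennreal_mult'[symmetric] power_divide)
  also have "\<dots> \<le> ennreal (1 / sqrt (2 * real k + 1))"
    using central_binomial_le[of k] by (intro ennreal_leI) (simp add: field_simps)
  finally show ?thesis .
qed

lemma pred_card_filter_eq:
  assumes "finite J" and [measurable]: "\<And>j. j \<in> J \<Longrightarrow> Measurable.pred M (\<lambda>x. R x j)"
  shows "Measurable.pred M (\<lambda>x. card {j \<in> J. R x j} = k)"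
proof -
  have "card {j \<in> J. R x j} = k \<longleftrightarrow> (\<exists>A\<in>{A. A \<subseteq> J \<and> card A = k}. \<forall>j\<in>J. R x j = (j \<in> A))" for x
  proof
    assume "card {j \<in> J. R x j} = k"
    thus "\<exists>A\<in>{A. A \<subseteq> J \<and> card A = k}. \<forall>j\<in>J. R x j = (j \<in> A)"
      by (intro bexI[of _ "{j \<in> J. R x j}"]) auto
  next
    assume "\<exists>A\<in>{A. A \<subseteq> J \<and> card A = k}. \<forall>j\<in>J. R x j = (j \<in> A)"
    then obtain A where "A \<subseteq> J" "card A = k" "\<forall>j\<in>J. R x j = (j \<in> A)" by blast
    moreover from this have "{j \<in> J. R x j} = A" by auto
    ultimately show "card {j \<in> J. R x j} = k" by simp
  qed
  moreover have "Measurable.pred M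
      (\<lambda>x. \<exists>A\<in>{A. A \<subseteq> J \<and> card A = k}. \<forall>j\<in>J. R x j = (j \<in> A))"
    using assms(1) by (intro pred_intros_finite) auto
  ultimately show ?thesis by simp
qed

text \<open>
  The parameter \<open>s\<close> is 1 or -1 and selects a side of the hyperplane through the points indexed by
  the range of \<open>\<sigma>\<close>. These points lie on the hyperplane and are left out of the count, so that the
  count only involves points independent of the hyperplane.
\<close>

definition splits_off ::
  "nat \<Rightarrow> 'i set \<Rightarrow> 'n \<Rightarrow> ('n \<Rightarrow> 'i) \<Rightarrow> real \<Rightarrow> ('i \<Rightarrow> real ^ 'n::finite) \<Rightarrow> bool" where
  "splits_off k N r0 \<sigma> s X \<longleftrightarrow>
     card {j \<in> N - range \<sigma>. s * facet_side r0 (\<lambda>r. X (\<sigma> r)) (X j) > 0} = k"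

lemma splits_off_measurable:
  assumes "sets P = sets (borel :: (real ^ 'n::finite) measure)" "finite N" "range \<sigma> \<subseteq> N"
  shows "Measurable.pred (\<Pi>\<^sub>M i\<in>N. P) (splits_off k N r0 \<sigma> s)"
proof -
  have comp: "(\<lambda>X. X i) \<in> borel_measurable (\<Pi>\<^sub>M i\<in>N. P)" if "i \<in> N" for i
    using measurable_component_singleton[OF that, of "\<lambda>_. P"] assms(1)
    by (simp cong: measurable_cong_sets)
  have "(\<lambda>X. s * facet_side r0 (\<lambda>r. X (\<sigma> r)) (X j)) \<in> borel_measurable (\<Pi>\<^sub>M i\<in>N. P)"
    if "j \<in> N - range \<sigma>" for j
    using that assms(3) by (intro borel_measurable_times facet_side_measurable comp) auto
  thus ?thesis
    unfolding splits_off_def using assms(2)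
    by (intro pred_card_filter_eq) auto
qed

text \<open>
  Once the points indexed by \<open>I = range \<sigma>\<close> are fixed, the chosen side is a fixed Borel set \<open>H\<close>,
  and the binomial estimate applies to the product over the other indices. Its bound does not
  depend on \<open>H\<close>, so integrating over the fixed points preserves it.
\<close>

lemma emeasure_splits_off_le:
  fixes \<sigma> :: "'n::finite \<Rightarrow> 'i"
  assumes "prob_space P" and borel: "sets P = sets (borel :: (real ^ 'n) measure)"
    and N: "finite N" "range \<sigma> \<subseteq> N" "card (N - range \<sigma>) = 2 * k"
  shows "emeasure (\<Pi>\<^sub>M i\<in>N. P) {X \<in> space (\<Pi>\<^sub>M i\<in>N. P). splits_off k N r0 \<sigma> s X}
    \<le> ennreal (1 / sqrt (2 * real k + 1))"
proof -
  interpret prob_space P by fact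
  interpret Pi: product_prob_space "\<lambda>_. P" UNIV ..
  define I where "I = range \<sigma>"
  define J where "J = N - I"
  define E where "E = {X \<in> space (\<Pi>\<^sub>M i\<in>N. P). splits_off k N r0 \<sigma> s X}"
  have IJ: "I \<inter> J = {}" "finite I" "finite J" "I \<union> J = N" "card J = 2 * k"
    using N finite_subset[OF N(2,1)] unfolding I_def J_def by auto
  have E: "E \<in> sets (\<Pi>\<^sub>M i\<in>N. P)"
    using splits_off_measurable[OF borel N(1,2)] unfolding E_def by simp
  have spaceP: "space P = UNIV" using sets_eq_imp_space_eq[OF borel] by simp
  have inner: "(\<integral>\<^sup>+ y. indicator E (merge I J (x, y)) \<partial>(\<Pi>\<^sub>M i\<in>J. P))
      \<le> ennreal (1 / sqrt (2 * real k + 1))" for x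
  proof -
    define H where "H = {v. s * facet_side r0 (\<lambda>r. x (\<sigma> r)) v > 0}"
    define F where "F = {y \<in> space (\<Pi>\<^sub>M i\<in>J. P). card {j \<in> J. y j \<in> H} = k}"
    have H: "H \<in> sets P"
      unfolding H_def borel by measurable
    have "Measurable.pred (\<Pi>\<^sub>M i\<in>J. P) (\<lambda>y. card {j \<in> J. y j \<in> H} = k)"
      using IJ(3) H by (intro pred_card_filter_eq) auto
    hence F: "F \<in> sets (\<Pi>\<^sub>M i\<in>J. P)" unfolding F_def by simp
    have "y \<in> F" if "y \<in> space (\<Pi>\<^sub>M i\<in>J. P)" "merge I J (x, y) \<in> E" for y
    proof -
      have "merge I J (x, y) (\<sigma> r) = x (\<sigma> r)" for r
        by (rule merge_apply(1)) (use IJ in \<open>auto simp: I_def\<close>)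
      moreover have "merge I J (x, y) j = y j" if "j \<in> J" for j
        by (rule merge_apply(2)) (use IJ that in auto)
      ultimately have "{j \<in> J. y j \<in> H} = {j \<in> N - range \<sigma>.
          s * facet_side r0 (\<lambda>r. merge I J (x, y) (\<sigma> r)) (merge I J (x, y) j) > 0}"
        unfolding H_def J_def I_def by auto
      with that show ?thesis unfolding F_def E_def splits_off_def by simp
    qed
    hence "(\<integral>\<^sup>+ y. indicator E (merge I J (x, y)) \<partial>(\<Pi>\<^sub>M i\<in>J. P))
        \<le> (\<integral>\<^sup>+ y. indicator F y \<partial>(\<Pi>\<^sub>M i\<in>J. P))"
      by (intro nn_integral_mono) (auto simp: indicator_def)
    also have "\<dots> = emeasure (\<Pi>\<^sub>M i\<in>J. P) F" using F by simp
    also have "\<dots> \<le> ennreal (1 / sqrt (2 * real k + 1))"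
      unfolding F_def by (rule emeasure_PiM_half_in_le[OF assms(1) H IJ(3,5)])
    finally show ?thesis .
  qed
  interpret PI: prob_space "\<Pi>\<^sub>M i\<in>I. P" by (rule prob_space_PiM) (rule assms(1))
  have "emeasure (\<Pi>\<^sub>M i\<in>N. P) E = (\<integral>\<^sup>+ X. indicator E X \<partial>(\<Pi>\<^sub>M i\<in>I \<union> J. P))"
    using E IJ(4) by simp
  also have "\<dots> = (\<integral>\<^sup>+ x. (\<integral>\<^sup>+ y. indicator E (merge I J (x, y)) \<partial>(\<Pi>\<^sub>M i\<in>J. P)) \<partial>(\<Pi>\<^sub>M i\<in>I. P))"
    using E IJ by (intro Pi.product_nn_integral_fold) auto
  also have "\<dots> \<le> (\<integral>\<^sup>+ x. ennreal (1 / sqrt (2 * real k + 1)) \<partial>(\<Pi>\<^sub>M i\<in>I. P))"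
    by (intro nn_integral_mono inner)
  also have "\<dots> = ennreal (1 / sqrt (2 * real k + 1))"
    by (simp add: PI.emeasure_space_1)
  finally show ?thesis unfolding E_def .
qed

section \<open>Counting facets by index sets\<close>

lemma AE_PiM_inj_on:
  fixes P :: "'a::{second_countable_topology, t2_space} measure"
  assumes "prob_space P" and borel: "sets P = sets borel"
    and null: "\<And>x. emeasure P {x} = 0" and N: "finite N"
  shows "AE X in (\<Pi>\<^sub>M i\<in>N. P). inj_on X N"
proof -
  interpret prob_space P by fact
  interpret Pi: product_prob_space "\<lambda>_. P" UNIV ..
  have pair: "AE X in (\<Pi>\<^sub>M i\<in>N. P). X i \<noteq> X j" if ij: "i \<in> N" "j \<in> N" "i \<noteq> j" for i j
  proof -
    define E where "E = {X \<in> space (\<Pi>\<^sub>M i\<in>N. P). X i = X j}"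
    define N' where "N' = N - {j}"
    have N': "finite N'" "j \<notin> N'" "insert j N' = N" using N ij unfolding N'_def by auto
    have comp: "(\<lambda>X. X i) \<in> borel_measurable (\<Pi>\<^sub>M i\<in>N. P)" if "i \<in> N" for i
      using measurable_component_singleton[OF that, of "\<lambda>_. P"] borel
      by (simp cong: measurable_cong_sets)
    note [measurable] = comp[OF ij(1)] comp[OF ij(2)]
    have E: "E \<in> sets (\<Pi>\<^sub>M i\<in>N. P)" unfolding E_def by measurable
    have "emeasure (\<Pi>\<^sub>M i\<in>N. P) E = (\<integral>\<^sup>+ X. indicator E X \<partial>(\<Pi>\<^sub>M i\<in>insert j N'. P))"
      using E N'(3) by simp
    also have "\<dots> = (\<integral>\<^sup>+ x. (\<integral>\<^sup>+ y. indicator E (x(j := y)) \<partial>P) \<partial>(\<Pi>\<^sub>M i\<in>N'. P))"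
      using E N' by (intro Pi.product_nn_integral_insert) auto
    also have "\<dots> \<le> (\<integral>\<^sup>+ x. (\<integral>\<^sup>+ y. indicator {x i} y \<partial>P) \<partial>(\<Pi>\<^sub>M i\<in>N'. P))"
      using ij by (intro nn_integral_mono) (auto simp: indicator_def E_def)
    also have "\<dots> = 0" using null borel by simp
    finally have "emeasure (\<Pi>\<^sub>M i\<in>N. P) E = 0" by simp
    thus ?thesis by (intro AE_I[OF _ _ E]) (auto simp: E_def)
  qed
  have "AE X in (\<Pi>\<^sub>M i\<in>N. P). \<forall>i\<in>N. \<forall>j\<in>N. i \<noteq> j \<longrightarrow> X i \<noteq> X j"
    using pair by (intro AE_finite_allI N) auto
  thus ?thesis by eventually_elim (auto simp: inj_on_def)
qed

text \<open>
  Each \<open>k\<close>-facet is the image of an index set and has \<open>k\<close> points on one of the sides \<open>s\<close>.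
  Injectivity of the sample makes counting points the same as counting indices.
\<close>

lemma card_k_facets_le:
  fixes X :: "'i \<Rightarrow> real ^ 'n::finite" and \<sigma> :: "'i set \<Rightarrow> 'n \<Rightarrow> 'i"
  assumes N: "finite N" and inj: "inj_on X N"
    and \<sigma>: "\<And>I. I \<subseteq> N \<Longrightarrow> card I = CARD('n) \<Longrightarrow> range (\<sigma> I) = I"
  defines "Q \<equiv> {I. I \<subseteq> N \<and> card I = CARD('n)} \<times> {1, -1}"
  shows "card {\<Delta>. k_facet k (X ` N) \<Delta>} \<le> card {q \<in> Q. splits_off k N r0 (\<sigma> (fst q)) (snd q) X}"
proof -
  have "finite {q \<in> Q. splits_off k N r0 (\<sigma> (fst q)) (snd q) X}"
    by (rule finite_subset[of _ Q]) (use N in \<open>auto simp: Q_def\<close>)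
  moreover have "{\<Delta>. k_facet k (X ` N) \<Delta>}
      \<subseteq> (\<lambda>q. X ` fst q) ` {q \<in> Q. splits_off k N r0 (\<sigma> (fst q)) (snd q) X}"
  proof
    fix \<Delta> assume "\<Delta> \<in> {\<Delta>. k_facet k (X ` N) \<Delta>}"
    then obtain a b where \<Delta>: "\<Delta> \<subseteq> X ` N" "card \<Delta> = CARD('n)"
      and a: "a \<noteq> 0" and hull: "affine hull \<Delta> = {x. a \<bullet> x = b}"
      and k: "card {x \<in> X ` N. a \<bullet> x < b} = k \<or> card {x \<in> X ` N. a \<bullet> x > b} = k"
      unfolding k_facet_def by auto
    define I where "I = {i \<in> N. X i \<in> \<Delta>}"
    have I: "I \<subseteq> N" "X ` I = \<Delta>" using \<Delta>(1) unfolding I_def by auto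
    have cardI: "card I = CARD('n)"
      using card_image[OF inj_on_subset[OF inj I(1)]] I(2) \<Delta>(2) by simp
    have range: "range (\<lambda>r. X (\<sigma> I r)) = \<Delta>"
      using \<sigma>[OF I(1) cardI] I(2) by (metis image_image)
    obtain c where c: "c \<noteq> 0"
      and side: "\<And>v. facet_side r0 (\<lambda>r. X (\<sigma> I r)) v = c * (a \<bullet> v - b)"
      using facet_side_proportional[OF a, of "\<lambda>r. X (\<sigma> I r)" b] hull unfolding range by blast
    have on: "a \<bullet> X j = b" if "j \<in> I" for j
      using hull_inc[of "X j" \<Delta> affine] that hull I by auto
    have card: "card {x \<in> X ` N. R x} = card {j \<in> N - range (\<sigma> I). R (X j)}"
      if "\<And>x. R x \<Longrightarrow> a \<bullet> x \<noteq> b" for R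
    proof -
      have "{x \<in> X ` N. R x} = X ` {j \<in> N - range (\<sigma> I). R (X j)}"
        using that on \<sigma>[OF I(1) cardI] by auto
      thus ?thesis by (simp add: card_image inj_on_subset[OF inj])
    qed
    \<comment> \<open>\<open>c\<close> may be negative, so the side \<open>s\<close> depends on its sign.\<close>
    have "\<exists>s\<in>{1, -1}. splits_off k N r0 (\<sigma> I) s X"
    proof (cases "card {x \<in> X ` N. a \<bullet> x > b} = k")
      case True
      have "splits_off k N r0 (\<sigma> I) (sgn c) X"
        using True card[of "\<lambda>x. a \<bullet> x > b"] c
        by (auto simp: splits_off_def side sgn_if zero_less_mult_iff mult_less_0_iff)
      thus ?thesis using c by (auto simp: sgn_if split: if_splits)
    next
      case False
      have "splits_off k N r0 (\<sigma> I) (- sgn c) X"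
        using False k card[of "\<lambda>x. a \<bullet> x < b"] c
        by (auto simp: splits_off_def side sgn_if zero_less_mult_iff mult_less_0_iff)
      thus ?thesis using c by (auto simp: sgn_if split: if_splits)
    qed
    then obtain s where "s \<in> {1, -1}" "splits_off k N r0 (\<sigma> I) s X" by blast
    hence "(I, s) \<in> {q \<in> Q. splits_off k N r0 (\<sigma> (fst q)) (snd q) X}"
      using I(1) cardI unfolding Q_def by auto
    thus "\<Delta> \<in> (\<lambda>q. X ` fst q) ` {q \<in> Q. splits_off k N r0 (\<sigma> (fst q)) (snd q) X}"
      using I(2) by (intro image_eqI[of _ _ "(I, s)"]) simp_all
  qed
  ultimately show ?thesis by (meson card_image_le card_mono finite_imageI le_trans)
qed

section \<open>The expected number of halving facets\<close>

theorem theorem1p2: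
  shows "\<exists>C>0. \<forall>P :: (real ^ 'n::finite) measure.
    prob_space P \<longrightarrow> sets P = sets borel \<longrightarrow>
    (\<forall>a b. a \<noteq> 0 \<longrightarrow> emeasure P {x. a \<bullet> x = b} = 0) \<longrightarrow>
    (\<forall>n. n > CARD('n) \<longrightarrow> even (n - CARD('n)) \<longrightarrow>
      expected_k_facets P ((n - CARD('n)) div 2) n
        \<le> ennreal (C * real n powr (real CARD('n) - 1 / 2)))"
proof (intro exI[of _ "2 * sqrt (real CARD('n))"] conjI allI impI)
  show "2 * sqrt (real CARD('n)) > 0" by simp
next
  fix P :: "(real ^ 'n) measure" and n :: nat
  assume P: "prob_space P" "sets P = sets borel"
    and hyp: "\<forall>a b. a \<noteq> 0 \<longrightarrow> emeasure P {x. a \<bullet> x = b} = 0"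
    and n: "n > CARD('n)" "even (n - CARD('n))"
  define k where "k = (n - CARD('n)) div 2"
  have k: "2 * k = n - CARD('n)" using n unfolding k_def by simp
  define Q :: "(nat set \<times> real) set"
    where "Q = {I. I \<subseteq> {..<n} \<and> card I = CARD('n)} \<times> {1, -1}"
  have Q: "finite Q" "card Q = 2 * (n choose CARD('n))"
    using n_subsets[of "{..<n}" "CARD('n)"] unfolding Q_def by (auto simp: card_cartesian_product)
  have "\<exists>f :: 'n \<Rightarrow> nat. range f = I" if "I \<subseteq> {..<n}" "card I = CARD('n)" for I
  proof -
    have "\<exists>f :: 'n \<Rightarrow> nat. bij_betw f UNIV I"
      using that by (intro finite_same_card_bij) (auto intro: finite_subset)
    thus ?thesis unfolding bij_betw_def by blast
  qed
  then obtain \<sigma> :: "nat set \<Rightarrow> 'n \<Rightarrow> nat"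
    where \<sigma>: "\<And>I. I \<subseteq> {..<n} \<Longrightarrow> card I = CARD('n) \<Longrightarrow> range (\<sigma> I) = I" by metis
  \<comment> \<open>an arbitrary base vertex\<close>
  define r0 :: 'n where "r0 = undefined"
  define M where "M = (\<Pi>\<^sub>M i\<in>{..<n}. P)"
  define E where "E q = {X \<in> space M. splits_off k {..<n} r0 (\<sigma> (fst q)) (snd q) X}" for q
  \<comment> \<open>Every point lies on some hyperplane, so \<open>P\<close> has no atoms and the sample is almost surely
    injective.\<close>
  have point: "emeasure P {x} = 0" for x
  proof -
    obtain a :: "real ^ 'n" where "a \<noteq> 0" using nonempty_Basis nonzero_Basis by blast
    have "emeasure P {x} \<le> emeasure P {y. a \<bullet> y = a \<bullet> x}"
      using P(2) by (intro emeasure_mono) auto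
    also have "\<dots> = 0" using hyp \<open>a \<noteq> 0\<close> by blast
    finally show ?thesis by simp
  qed
  have range: "range (\<sigma> (fst q)) \<subseteq> {..<n}" "card ({..<n} - range (\<sigma> (fst q))) = 2 * k"
    if "q \<in> Q" for q
  proof -
    have q: "fst q \<subseteq> {..<n}" "card (fst q) = CARD('n)"
      using that unfolding Q_def by auto
    note \<sigma>[OF q]
    with q show "range (\<sigma> (fst q)) \<subseteq> {..<n}" by simp
    show "card ({..<n} - range (\<sigma> (fst q))) = 2 * k"
      using q \<sigma>[OF q] k finite_subset[OF q(1)] by (simp add: card_Diff_subset)
  qed
  have E: "E q \<in> sets M" if "q \<in> Q" for q
    using splits_off_measurable[OF P(2) finite_lessThan range(1)[OF that]] unfolding E_def M_def
    by simp
  have "AE X in M. of_nat (card {\<Delta>. k_facet k (X ` {..<n}) \<Delta>})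
      \<le> (\<Sum>q\<in>Q. indicator (E q) X :: ennreal)"
    using AE_PiM_inj_on[OF P point finite_lessThan[of n]] AE_space unfolding M_def[symmetric]
  proof eventually_elim
    case (elim X)
    have "card {\<Delta>. k_facet k (X ` {..<n}) \<Delta>} \<le> card {q \<in> Q. X \<in> E q}"
      using card_k_facets_le[OF finite_lessThan elim(1) \<sigma>, of k r0] elim(2)
      unfolding Q_def E_def by simp
    moreover have "(\<Sum>q\<in>Q. indicator (E q) X :: ennreal) = of_nat (card {q \<in> Q. X \<in> E q})"
      using Q(1) by (simp add: indicator_def sum.If_cases Int_def)
    ultimately show ?case by simp
  qed
  hence "expected_k_facets P k n \<le> (\<integral>\<^sup>+ X. (\<Sum>q\<in>Q. indicator (E q) X) \<partial>M)"
    unfolding expected_k_facets_def M_def[symmetric] by (rule nn_integral_mono_AE)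
  also have "\<dots> = (\<Sum>q\<in>Q. emeasure M (E q))"
    using E by (subst nn_integral_sum) auto
  also have "\<dots> \<le> (\<Sum>q\<in>Q. ennreal (1 / sqrt (2 * real k + 1)))"
    unfolding E_def M_def
    by (intro sum_mono emeasure_splits_off_le[OF P] range) auto
  also have "\<dots> = ennreal (2 * real (n choose CARD('n)) / sqrt (2 * real k + 1))"
    by (simp add: Q ennreal_of_nat_eq_real_of_nat ennreal_mult'[symmetric])
  also have "\<dots> \<le> ennreal (2 * sqrt (real CARD('n)) * real n powr (real CARD('n) - 1 / 2))"
  proof (intro ennreal_leI)
    have d: "real CARD('n) \<ge> 1" by simp
    have n0: "real n > 0" using n by simp
    have "real n = 2 * real k + real CARD('n)" using k n by linarith
    also have "\<dots> \<le> real CARD('n) * (2 * real k + 1)"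
      using mult_right_mono[OF d, of "2 * real k"] by (simp add: algebra_simps)
    finally have "sqrt (real n) \<le> sqrt (real CARD('n)) * sqrt (2 * real k + 1)"
      by (metis real_sqrt_le_iff real_sqrt_mult)
    hence inv: "1 / sqrt (2 * real k + 1) \<le> sqrt (real CARD('n)) / sqrt (real n)"
      using n0 by (simp add: field_simps)
    have "real (n choose CARD('n)) \<le> real n ^ CARD('n)"
      using binomial_le_pow[of "CARD('n)" n] n by (metis less_imp_le of_nat_le_iff of_nat_power)
    hence "2 * real (n choose CARD('n)) * (1 / sqrt (2 * real k + 1))
        \<le> 2 * real n ^ CARD('n) * (sqrt (real CARD('n)) / sqrt (real n))"
      using inv by (intro mult_mono) auto
    also have "\<dots> = 2 * sqrt (real CARD('n)) * real n powr (real CARD('n) - 1 / 2)"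
      using n0 by (simp add: powr_diff powr_realpow powr_half_sqrt)
    finally show "2 * real (n choose CARD('n)) / sqrt (2 * real k + 1)
        \<le> 2 * sqrt (real CARD('n)) * real n powr (real CARD('n) - 1 / 2)" by simp
  qed
  finally show "expected_k_facets P ((n - CARD('n)) div 2) n
      \<le> ennreal (2 * sqrt (real CARD('n)) * real n powr (real CARD('n) - 1 / 2))"
    unfolding k_def .
qed

end
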